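(* Let $a$ and $b$ be two integers with $2\leq a\leq b$, and let $G$ be a graph of order $n$ with $n\geq\frac{(a+2b)(a+b-2)+2}{b}$. If $bind(G)>\frac{(a+2b-1)(n-1)}{bn-(a+b)}$, then $G$ is fractional ID-$[a,b]$-factor-critical covered.
   Context: All graphs are finite and simple, with vertex set $V(G)$ and edge set $E(G)$; the order of $G$ is $|V(G)|$. For $x\in V(G)$, $N_G(x)$ is the set of vertices adjacent to $x$ in $G$, and for $X\subseteq V(G)$, $N_G(X)=\bigcup_{x\in X}N_G(x)$. The binding number of $G$ is $$bind(G)=\min\left\{\frac{|N_G(X)|}{|X|}:\emptyset\neq X\subseteq V(G),\ N_G(X)\neq V(G)\right\}.$$ A set $I\subseteq V(G)$ is independent if the induced subgraph $G[I]$ has no edges; $G-I=G[V(G)\setminus I]$. For positive integers $a\leq b$, a fractional $[a,b]$-factor of a graph $G$ with indicator function $h$ is given by a function $h:E(G)\rightarrow[0,1]$ such that $a\leq\sum_{e\ni x}h(e)\leq b$ for every $x\in V(G)$ (the sum is over edges $e$ incident with $x$); the fractional factor is the subgraph $G[F_h]$, where $F_h=\{e\in E(G):h(e)>0\}$. A graph $G$ is fractional $[a,b]$-covered if for every edge $e\in E(G)$, $G$ admits a fractional $[a,b]$-factor with indicator function $h$ (which may depend on $e$) satisfying $h(e)=1$. A graph $G$ is fractional ID-$[a,b]$-factor-critical covered if $G-I$ is fractional $[a,b]$-covered for every independent set $I$ of $G$. *)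

theory Defs
  imports Complex_Main
begin

record 'a graph =
  verts :: "'a set"
  edges :: "'a set set"

text \<open>Edges are two-element vertex sets, so loops and multiple edges are excluded.\<close>

definition simple_graph :: "'a graph \<Rightarrow> bool" where
  "simple_graph G \<longleftrightarrow>
     finite (verts G) \<and> (\<forall>e\<in>edges G. e \<subseteq> verts G \<and> card e = 2)"

definition graph_order :: "'a graph \<Rightarrow> nat" where
  "graph_order G = card (verts G)"

definition nbrs :: "'a graph \<Rightarrow> 'a \<Rightarrow> 'a set" where
  "nbrs G x = {y \<in> verts G. {x, y} \<in> edges G}"

definition nbrs_set :: "'a graph \<Rightarrow> 'a set \<Rightarrow> 'a set" where
  "nbrs_set G X = (\<Union>x\<in>X. nbrs G x)"

text \<open>The minimum below is over a finite set, nonempty as soon as the graph has a vertex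
  (lemma \<open>binding_ratios_finite_nonempty\<close>), so \<^const>\<open>Min\<close> is meaningful there.
  The null graph has no admissible \<open>X\<close>; its binding number is unspecified.\<close>

definition binding_ratios :: "'a graph \<Rightarrow> real set" where
  "binding_ratios G =
     {real (card (nbrs_set G X)) / real (card X) | X.
        X \<noteq> {} \<and> X \<subseteq> verts G \<and> nbrs_set G X \<noteq> verts G}"

definition binding_number :: "'a graph \<Rightarrow> real" where
  "binding_number G = Min (binding_ratios G)"

lemma binding_ratios_finite_nonempty:
  assumes "simple_graph G" "verts G \<noteq> {}"
  shows "finite (binding_ratios G)" "binding_ratios G \<noteq> {}"
proof -
  have "binding_ratios G
      \<subseteq> (\<lambda>X. real (card (nbrs_set G X)) / real (card X)) ` Pow (verts G)"
    unfolding binding_ratios_def by blast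
  then show "finite (binding_ratios G)"
    using assms(1) unfolding simple_graph_def
    by (meson finite_Pow_iff finite_imageI finite_subset)
  obtain v where v: "v \<in> verts G" using assms(2) by blast
  have "{v} \<notin> edges G"
    using assms(1) unfolding simple_graph_def by fastforce
  then have "v \<notin> nbrs_set G {v}"
    unfolding nbrs_set_def nbrs_def by simp
  with v have "{v} \<noteq> {} \<and> {v} \<subseteq> verts G \<and> nbrs_set G {v} \<noteq> verts G"
    by blast
  then show "binding_ratios G \<noteq> {}"
    unfolding binding_ratios_def by blast
qed

definition induced :: "'a graph \<Rightarrow> 'a set \<Rightarrow> 'a graph" where
  "induced G X = \<lparr>verts = X, edges = {e \<in> edges G. e \<subseteq> X}\<rparr>"

definition edge_induced :: "'a graph \<Rightarrow> 'a set set \<Rightarrow> 'a graph" where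
  "edge_induced G F = \<lparr>verts = \<Union>(edges G \<inter> F), edges = edges G \<inter> F\<rparr>"

definition delete_verts :: "'a graph \<Rightarrow> 'a set \<Rightarrow> 'a graph" where
  "delete_verts G I = induced G (verts G - I)"

definition independent_set :: "'a graph \<Rightarrow> 'a set \<Rightarrow> bool" where
  "independent_set G I \<longleftrightarrow> I \<subseteq> verts G \<and> edges (induced G I) = {}"

text \<open>\<open>fractional_factor a b G h H\<close>: \<open>H\<close> is the fractional \<open>[a,b]\<close>-factor of \<open>G\<close> with
  indicator function \<open>h\<close>. Only the values of \<open>h\<close> on edges of \<open>G\<close> matter.\<close>

definition fractional_factor ::
    "nat \<Rightarrow> nat \<Rightarrow> 'a graph \<Rightarrow> ('a set \<Rightarrow> real) \<Rightarrow> 'a graph \<Rightarrow> bool" where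
  "fractional_factor a b G h H \<longleftrightarrow>
     (\<forall>e\<in>edges G. 0 \<le> h e \<and> h e \<le> 1) \<and>
     (\<forall>x\<in>verts G. real a \<le> (\<Sum>e\<in>{e \<in> edges G. x \<in> e}. h e) \<and>
                   (\<Sum>e\<in>{e \<in> edges G. x \<in> e}. h e) \<le> real b) \<and>
     H = edge_induced G {e \<in> edges G. h e > 0}"

definition fractional_covered :: "nat \<Rightarrow> nat \<Rightarrow> 'a graph \<Rightarrow> bool" where
  "fractional_covered a b G \<longleftrightarrow>
     (\<forall>e\<in>edges G. \<exists>h H. fractional_factor a b G h H \<and> h e = 1)"

definition fractional_ID_factor_critical_covered :: "nat \<Rightarrow> nat \<Rightarrow> 'a graph \<Rightarrow> bool" where
  "fractional_ID_factor_critical_covered a b G \<longleftrightarrow>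
     (\<forall>I. independent_set G I \<longrightarrow> fractional_covered a b (delete_verts G I))"

end

theory Submission
  imports Defs "HOL-Analysis.Function_Topology"
begin

text \<open>If some edge of \<open>H = G - I\<close> is not covered, minimising the total squared deficit of an edge
  weighting yields disjoint \<open>S\<close> and \<open>T \<noteq> {}\<close> with
  \<open>b |S| + (\<Sum>x\<in>T. |N\<^sub>H(x) - S|) \<le> a |T| + 1\<close>. Testing the binding number on the sets \<open>V - N(v)\<close>
  bounds the degrees of \<open>G\<close> from below and \<open>|I|\<close> from above. If the least \<open>|N\<^sub>H(x) - S|\<close> on \<open>T\<close>
  is positive, these bounds contradict the inequality; if it is zero, the binding number is
  tested once more on \<open>V - (S \<union> I)\<close>, whose neighbourhood misses the vertices of \<open>T\<close> isolated
  in \<open>H - S\<close>.\<close>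

section \<open>Weighted degrees and neighbourhoods\<close>

definition wdeg :: "'a graph \<Rightarrow> ('a set \<Rightarrow> real) \<Rightarrow> 'a \<Rightarrow> real" where
  "wdeg G h x = (\<Sum>e\<in>{e \<in> edges G. x \<in> e}. h e)"

lemma finite_edges: "simple_graph G \<Longrightarrow> finite (edges G)"
  unfolding simple_graph_def by (meson Pow_iff finite_Pow_iff rev_finite_subset subsetI)

lemma finite_nbrs: "simple_graph G \<Longrightarrow> finite (nbrs G x)"
  unfolding simple_graph_def nbrs_def by simp

lemma nbrs_sym: "y \<in> nbrs G x \<Longrightarrow> x \<in> verts G \<Longrightarrow> x \<in> nbrs G y"
  by (simp add: nbrs_def insert_commute)

lemma not_in_own_nbrs: "simple_graph G \<Longrightarrow> x \<notin> nbrs G x"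
  by (fastforce simp: simple_graph_def nbrs_def)

lemma wdeg_eq_sum_nbrs:
  assumes G: "simple_graph G"
  shows "wdeg G h x = (\<Sum>y\<in>nbrs G x. h {x, y})"
proof -
  have "inj_on (\<lambda>y. {x, y}) (nbrs G x)"
    by (auto simp: inj_on_def doubleton_eq_iff)
  moreover have "(\<lambda>y. {x, y}) ` nbrs G x = {e \<in> edges G. x \<in> e}"
  proof safe
    fix e assume e: "e \<in> edges G" "x \<in> e"
    then have "card e = 2" "e \<subseteq> verts G" using G by (auto simp: simple_graph_def)
    then obtain y where "e = {x, y}" using e by (auto simp: card_2_iff)
    then show "e \<in> (\<lambda>y. {x, y}) ` nbrs G x"
      using e \<open>e \<subseteq> verts G\<close> by (auto simp: nbrs_def)
  qed (auto simp: nbrs_def)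
  ultimately show ?thesis
    unfolding wdeg_def by (metis (no_types, lifting) sum.reindex_cong)
qed

lemma wdeg_upd:
  assumes "simple_graph G" "e \<in> edges G"
  shows "wdeg G (h(e := h e + r)) x = wdeg G h x + (if x \<in> e then r else 0)"
proof -
  have "wdeg G (h(e := h e + r)) x
      = (\<Sum>f\<in>{f \<in> edges G. x \<in> f}. h f + (if f = e then r else 0))"
    unfolding wdeg_def by (rule sum.cong) auto
  also have "\<dots> = wdeg G h x + (if x \<in> e then r else 0)"
    using assms finite_edges[OF assms(1)] by (simp add: sum.distrib wdeg_def)
  finally show ?thesis .
qed

section \<open>The squared deficit of a degree\<close>

text \<open>Squaring makes the penalty strictly convex below \<open>a\<close>, so evening out two
  degrees lowers the total strictly; a linear penalty could stay constant when both lie below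
  \<open>a\<close>.\<close>

definition deficit :: "real \<Rightarrow> real \<Rightarrow> real" where
  "deficit a u = (max 0 (a - u))\<^sup>2"

lemma deficit_antimono: "u \<le> v \<Longrightarrow> deficit a v \<le> deficit a u"
  unfolding deficit_def by (intro power_mono) auto

lemma deficit_strict_antimono: "u < a \<Longrightarrow> u < v \<Longrightarrow> deficit a v < deficit a u"
  unfolding deficit_def by (intro power_strict_mono) auto

text \<open>The gap is at least \<open>2 * r\<close>, so moving \<open>r\<close> does not overshoot.
  Either \<open>v - r\<close> still reaches \<open>a\<close>, or both \<open>u\<close> and
  \<open>v\<close> are at most \<open>a\<close> and convexity applies, or \<open>v\<close> drops
  from above \<open>a\<close> to below it and its new penalty is at most
  \<open>r * r\<close>.\<close>

lemma deficit_transfer: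
  assumes "u < a" "0 < r" "u + 2 * r \<le> v"
  shows "deficit a (u + r) + deficit a (v - r) < deficit a u + deficit a v"
proof (cases "v - r \<ge> a")
  case True
  then have "deficit a (v - r) = 0" "deficit a v = 0"
    using assms by (auto simp: deficit_def)
  then show ?thesis
    using deficit_strict_antimono[of u a "u + r"] assms by simp
next
  case False
  define p q where "p = a - u" and "q = a - v"
  have pq: "p > r" "q + r > 0" "q \<le> p - 2 * r" "r > 0"
    using False assms by (auto simp: p_def q_def)
  have eqs: "deficit a u = p\<^sup>2" "deficit a (u + r) = (p - r)\<^sup>2" "deficit a (v - r) = (q + r)\<^sup>2"
    using pq by (auto simp: deficit_def p_def q_def max_def algebra_simps)
  show ?thesis
  proof (cases "q \<ge> 0")
    case True
    then have "deficit a v = q\<^sup>2" by (simp add: deficit_def q_def)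
    moreover have "2 * r * (q - p + r) < 0" using pq by (intro mult_pos_neg) auto
    ultimately show ?thesis unfolding eqs by (simp add: power2_eq_square algebra_simps)
  next
    case False
    then have "(q + r)\<^sup>2 \<le> r\<^sup>2" using pq by (intro power_mono) auto
    moreover have "r * r < r * p" using pq by simp
    moreover have "deficit a v \<ge> 0" by (simp add: deficit_def)
    ultimately show ?thesis unfolding eqs by (simp add: power2_eq_square algebra_simps)
  qed
qed

section \<open>Existence of a minimiser\<close>

text \<open>The cap \<open>b\<close> and the value on \<open>e0\<close> are hard constraints; the
  lower bound \<open>a\<close> is left to the penalty. Constraining \<open>h\<close> on all sets,
  edges or not, makes this a closed part of a full cube, hence compact.\<close>

definition capped :: "'a graph \<Rightarrow> real \<Rightarrow> 'a set \<Rightarrow> ('a set \<Rightarrow> real) set" where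
  "capped G b e0 = {h. (\<forall>e. 0 \<le> h e \<and> h e \<le> 1) \<and> h e0 = 1 \<and> (\<forall>x\<in>verts G. wdeg G h x \<le> b)}"

text \<open>Tychonoff's theorem, as the function type carries the product topology.\<close>

lemma compact_unit_cube: "compact {h :: 'b \<Rightarrow> real. \<forall>e. 0 \<le> h e \<and> h e \<le> 1}"
proof -
  have "compactin (product_topology (\<lambda>_. euclidean) UNIV) (PiE UNIV (\<lambda>_::'b. {0..1::real}))"
    by (simp add: compactin_PiE)
  moreover have "PiE UNIV (\<lambda>_::'b. {0..1::real}) = {h. \<forall>e. 0 \<le> h e \<and> h e \<le> 1}"
    by (auto simp: PiE_def Pi_def)
  ultimately show ?thesis
    by (simp add: euclidean_product_topology)
qed

lemma continuous_on_wdeg: "continuous_on UNIV (\<lambda>h. wdeg G h x)"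
  unfolding wdeg_def by (intro continuous_intros continuous_on_product_coordinates)

lemma compact_capped: "compact (capped G b e0)"
proof -
  have "closed ({h. h e0 = 1} \<inter> (\<Inter>x\<in>verts G. {h. wdeg G h x \<le> b}))"
    by (intro closed_Int closed_INT ballI closed_Collect_eq closed_Collect_le
        continuous_on_wdeg continuous_on_const continuous_on_product_coordinates)
  from compact_Int_closed[OF compact_unit_cube this] show ?thesis
    by (rule back_subst[of compact]) (auto simp: capped_def)
qed

lemma capped_minimiser:
  assumes "simple_graph G" "e0 \<in> edges G" "1 \<le> b"
  obtains h where "h \<in> capped G b e0"
    "\<And>k. k \<in> capped G b e0 \<Longrightarrow>
       (\<Sum>x\<in>verts G. deficit a (wdeg G h x)) \<le> (\<Sum>x\<in>verts G. deficit a (wdeg G k x))"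
proof -
  \<comment> \<open>The indicator of \<open>e0\<close> has degrees at most 1, so
    \<open>1 \<le> b\<close> makes it feasible.\<close>
  have "wdeg G (\<lambda>e. if e = e0 then 1 else 0) x \<le> b" for x
    using assms finite_edges[OF assms(1)] by (simp add: wdeg_def)
  then have "(\<lambda>e. if e = e0 then 1 else 0) \<in> capped G b e0"
    by (simp add: capped_def)
  then have "capped G b e0 \<noteq> {}" by blast
  moreover have "continuous_on (capped G b e0) (\<lambda>h. \<Sum>x\<in>verts G. deficit a (wdeg G h x))"
    unfolding deficit_def
    by (intro continuous_intros continuous_on_subset[OF continuous_on_wdeg]) auto
  ultimately show ?thesis
    using continuous_attains_inf[OF compact_capped] that by metis
qed

section \<open>The obstruction produced by an uncovered edge\<close>

lemma sum_less_if_changed_two: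
  fixes f g :: "'b \<Rightarrow> real"
  assumes "finite V" "x \<in> V" "y \<in> V" "x \<noteq> y"
    and "\<And>z. z \<in> V \<Longrightarrow> z \<noteq> x \<Longrightarrow> z \<noteq> y \<Longrightarrow> f z = g z" and "f x + f y < g x + g y"
  shows "sum f V < sum g V"
proof -
  have "sum k V = k x + k y + sum k (V - {x, y})" for k :: "'b \<Rightarrow> real"
    using sum.subset_diff[of "{x, y}" V k] assms(1-4) by simp
  moreover have "sum f (V - {x, y}) = sum g (V - {x, y})"
    using assms(5) by (intro sum.cong) auto
  ultimately show ?thesis using assms(6) by simp
qed

text \<open>Take \<open>T\<close> to be the vertices of least degree under a minimiser of the total squared deficit
  and \<open>S\<close> the vertices reached from \<open>T\<close> by an unsaturated edge. As the deficit is strictly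
  convex below \<open>a\<close>, exchanges along paths of one or two edges already force the degrees on \<open>S\<close>
  to be \<open>b\<close> and all weight at \<open>S\<close>, except that of \<open>e0\<close>, to come from \<open>T\<close>.\<close>

lemma not_covered_obstruction:
  fixes a b :: nat
  assumes G: "simple_graph G" and e0: "e0 \<in> edges G" and ab: "a \<le> b" "1 \<le> b"
    and no: "\<nexists>h H. fractional_factor a b G h H \<and> h e0 = 1"
  obtains S T where "S \<subseteq> verts G" "T \<subseteq> verts G" "S \<inter> T = {}" "T \<noteq> {}"
    "\<And>x. x \<in> T \<Longrightarrow> card (nbrs G x - S) < a"
    "b * card S + (\<Sum>x\<in>T. card (nbrs G x - S)) < a * card T + 2"
proof -
  let ?V = "verts G"
  have fV: "finite ?V" using G by (simp add: simple_graph_def)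
  obtain h where hC: "h \<in> capped G b e0"
    and hmin: "\<And>k. k \<in> capped G b e0 \<Longrightarrow>
       (\<Sum>x\<in>?V. deficit a (wdeg G h x)) \<le> (\<Sum>x\<in>?V. deficit a (wdeg G k x))"
    using capped_minimiser[OF G e0, of b a] ab by auto
  have h01: "0 \<le> h e" "h e \<le> 1" and he0: "h e0 = 1" and hb: "x \<in> ?V \<Longrightarrow> wdeg G h x \<le> b" for e x
    using hC by (auto simp: capped_def)
  \<comment> \<open>Otherwise \<open>h\<close> itself would be a factor with value 1 on
    \<open>e0\<close>.\<close>
  obtain x0 where x0: "x0 \<in> ?V" "wdeg G h x0 < a"
  proof (rule ccontr)
    assume "\<not> thesis"
    then have "\<forall>x\<in>?V. real a \<le> wdeg G h x" using that by force
    then have "fractional_factor a b G h (edge_induced G {e \<in> edges G. h e > 0})"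
      using h01 hb by (simp add: fractional_factor_def wdeg_def)
    then show False using no he0 by blast
  qed
  define m where "m = Min (wdeg G h ` ?V)"
  have m: "x \<in> ?V \<Longrightarrow> m \<le> wdeg G h x" for x using fV by (simp add: m_def)
  have ma: "m < a" using m[OF x0(1)] x0(2) by simp
  define T where "T = {x \<in> ?V. wdeg G h x = m}"
  define S where "S = {y \<in> ?V. \<exists>x\<in>T. y \<in> nbrs G x \<and> h {x, y} < 1}"
  have TV: "T \<subseteq> ?V" and SV: "S \<subseteq> ?V" by (auto simp: T_def S_def)
  have fT: "finite T" and fS: "finite S" using finite_subset[OF _ fV] TV SV by auto
  have "m \<in> wdeg G h ` ?V" unfolding m_def using fV x0(1) by (intro Min_in) auto
  then have Tne: "T \<noteq> {}" by (auto simp: T_def)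
  \<comment> \<open>A vertex \<open>y\<close> of \<open>S\<close> below \<open>b\<close> would let
    its unsaturated edge to some \<open>x\<close> in \<open>T\<close> take more weight: the penalty
    drops at \<open>x\<close> and does not grow at \<open>y\<close>.\<close>
  have Sb: "wdeg G h y = b" if yS: "y \<in> S" for y
  proof (rule ccontr)
    assume "wdeg G h y \<noteq> b"
    then have yb: "wdeg G h y < b" using hb[of y] yS SV by force
    obtain x where x: "x \<in> T" "y \<in> nbrs G x" "h {x, y} < 1" using yS by (auto simp: S_def)
    have xy: "x \<noteq> y" "x \<in> ?V" "y \<in> ?V" "{x, y} \<in> edges G" "wdeg G h x = m"
      using x not_in_own_nbrs[OF G] by (auto simp: T_def nbrs_def)
    \<comment> \<open>These bounds keep the edge weight at most 1 and the degrees of both ends at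
      most \<open>b\<close>.\<close>
    define r where "r = min (1 - h {x, y}) (min (b - m) (b - wdeg G h y))"
    have r: "r > 0" "r \<le> 1 - h {x, y}" "r \<le> b - m" "r \<le> b - wdeg G h y"
      using x(3) yb ma ab(1) by (auto simp: r_def)
    define k where "k = h({x, y} := h {x, y} + r)"
    have kd: "wdeg G k z = wdeg G h z + (if z \<in> {x, y} then r else 0)" for z
      unfolding k_def by (rule wdeg_upd[OF G xy(4)])
    have "k e0 = 1" using x(3) he0 by (auto simp: k_def)
    moreover have "0 \<le> k e \<and> k e \<le> 1" for e using r h01[of e] by (auto simp: k_def)
    moreover have "wdeg G k z \<le> b" if "z \<in> ?V" for z
      using hb[OF that] r xy(5) by (auto simp: kd)
    ultimately have "k \<in> capped G b e0" by (simp add: capped_def)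
    moreover have "(\<Sum>x\<in>?V. deficit a (wdeg G k x)) < (\<Sum>x\<in>?V. deficit a (wdeg G h x))"
      using xy(2,3,1)
    proof (rule sum_less_if_changed_two[OF fV])
      have "deficit a (wdeg G k x) < deficit a (wdeg G h x)"
        using ma r xy by (intro deficit_strict_antimono) (auto simp: kd)
      moreover have "deficit a (wdeg G k y) \<le> deficit a (wdeg G h y)"
        using r by (intro deficit_antimono) (auto simp: kd)
      ultimately show "deficit a (wdeg G k x) + deficit a (wdeg G k y)
          < deficit a (wdeg G h x) + deficit a (wdeg G h y)" by simp
    qed (auto simp: kd)
    ultimately show False using hmin by fastforce
  qed
  have ST: "S \<inter> T = {}" using Sb ma ab(1) by (force simp: T_def)
  \<comment> \<open>Otherwise weight could move from \<open>{y, z}\<close> to \<open>{x, y}\<close>: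
    the degree of \<open>y\<close> stays, while \<open>x\<close> gains what \<open>z\<close> loses.
    The edge \<open>e0\<close> is exempt because its weight must remain 1.\<close>
  have S0: "h {y, z} = 0" if yS: "y \<in> S" and z: "z \<in> nbrs G y" "z \<notin> T" "{y, z} \<noteq> e0" for y z
  proof (rule ccontr)
    assume "h {y, z} \<noteq> 0"
    then have yz0: "h {y, z} > 0" using h01[of "{y, z}"] by simp
    obtain x where x: "x \<in> T" "y \<in> nbrs G x" "h {x, y} < 1" using yS by (auto simp: S_def)
    have xy: "x \<noteq> y" "x \<in> ?V" "y \<in> ?V" "{x, y} \<in> edges G" "wdeg G h x = m"
      using x not_in_own_nbrs[OF G] by (auto simp: T_def nbrs_def)
    have zV: "z \<in> ?V" "z \<noteq> x" "z \<noteq> y" "{y, z} \<in> edges G"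
      using z x not_in_own_nbrs[OF G] by (auto simp: nbrs_def)
    have zm: "m < wdeg G h z" using m[OF zV(1)] z(2) zV(1) by (force simp: T_def)
    \<comment> \<open>Half the gap between \<open>z\<close> and \<open>x\<close> is what
      \<open>deficit_transfer\<close> allows; it is positive because \<open>z\<close> lies outside
      \<open>T\<close>.\<close>
    define r where "r = min (min (1 - h {x, y}) (h {y, z})) ((wdeg G h z - m) / 2)"
    have r: "r > 0" "r \<le> 1 - h {x, y}" "r \<le> h {y, z}" "m + 2 * r \<le> wdeg G h z"
      using x(3) yz0 zm by (auto simp: r_def min_def field_simps)
    define k' where "k' = h({x, y} := h {x, y} + r)"
    define k where "k = k'({y, z} := k' {y, z} + (- r))"
    have ne: "{x, y} \<noteq> {y, z}" using zV xy by (auto simp: doubleton_eq_iff)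
    have kd: "wdeg G k v = wdeg G h v + (if v \<in> {x, y} then r else 0) + (if v \<in> {y, z} then - r else 0)" for v
      unfolding k_def wdeg_upd[OF G zV(4)] unfolding k'_def wdeg_upd[OF G xy(4)] ..
    have "k e0 = 1" using x(3) he0 z(3) by (auto simp: k_def k'_def)
    moreover have "0 \<le> k e \<and> k e \<le> 1" for e
      using r h01[of e] ne by (auto simp: k_def k'_def)
    moreover have "wdeg G k v \<le> b" if "v \<in> ?V" for v
      using hb[OF that] hb[OF zV(1)] r xy(5) by (auto simp: kd)
    ultimately have "k \<in> capped G b e0" by (simp add: capped_def)
    moreover have "(\<Sum>x\<in>?V. deficit a (wdeg G k x)) < (\<Sum>x\<in>?V. deficit a (wdeg G h x))"
      using xy(2) zV(1) zV(2)[symmetric]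
    proof (rule sum_less_if_changed_two[OF fV])
      show "deficit a (wdeg G k x) + deficit a (wdeg G k z)
          < deficit a (wdeg G h x) + deficit a (wdeg G h z)"
        using deficit_transfer[OF ma r(1) r(4)] xy(1,5) zV(2,3) by (simp add: kd)
    qed (auto simp: kd)
    ultimately show False using hmin by fastforce
  qed
  \<comment> \<open>By the choice of \<open>S\<close>, edges from \<open>T\<close> to vertices
    outside \<open>S\<close> are saturated and count 1 each.\<close>
  have split: "m = real (card (nbrs G x - S)) + (\<Sum>y\<in>nbrs G x \<inter> S. h {x, y})" if x: "x \<in> T" for x
  proof -
    have "m = (\<Sum>y\<in>nbrs G x - S. h {x, y}) + (\<Sum>y\<in>nbrs G x \<inter> S. h {x, y})"
      using x wdeg_eq_sum_nbrs[OF G, of h x] finite_nbrs[OF G, of x]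
      by (simp add: T_def sum.Int_Diff[of "nbrs G x" _ S])
    also have "(\<Sum>y\<in>nbrs G x - S. h {x, y}) = (\<Sum>y\<in>nbrs G x - S. 1)"
    proof (rule sum.cong)
      fix y assume "y \<in> nbrs G x - S"
      then show "h {x, y} = 1" using x h01(2)[of "{x, y}"] by (force simp: S_def nbrs_def)
    qed simp
    finally show ?thesis by simp
  qed
  \<comment> \<open>The degree \<open>b\<close> of \<open>y\<close> comes from \<open>T\<close>,
    except for at most the unit weight of \<open>e0\<close>.\<close>
  have Sflow: "real b \<le> (\<Sum>x\<in>nbrs G y \<inter> T. h {y, x}) + (if y \<in> e0 then 1 else 0)" if y: "y \<in> S" for y
  proof -
    have "(\<Sum>z\<in>nbrs G y - T. h {y, z}) \<le> (\<Sum>z\<in>nbrs G y. if {y, z} = e0 then 1 else 0)"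
      using finite_nbrs[OF G, of y] S0[OF y] he0
      by (intro order.trans[OF sum_mono sum_mono2[of "nbrs G y" "nbrs G y - T"]]) auto
    also have "\<dots> = wdeg G (\<lambda>e. if e = e0 then 1 else 0) y"
      by (rule wdeg_eq_sum_nbrs[OF G, symmetric])
    also have "\<dots> = (if y \<in> e0 then 1 else 0)"
      using finite_edges[OF G] e0 by (simp add: wdeg_def)
    finally show ?thesis
      using Sb[OF y] wdeg_eq_sum_nbrs[OF G, of h y] finite_nbrs[OF G, of y]
      by (simp add: sum.Int_Diff[of "nbrs G y" _ T])
  qed
  \<comment> \<open>The two ends of \<open>e0\<close> are the source of the 2 in the
    conclusion.\<close>
  have e0S: "(\<Sum>y\<in>S. if y \<in> e0 then 1 else (0::real)) \<le> 2"
  proof -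
    have "finite e0" "card e0 = 2" using G e0 by (auto simp: simple_graph_def card_ge_0_finite)
    moreover have "(\<Sum>y\<in>S. if y \<in> e0 then 1 else (0::real)) = real (card (S \<inter> e0))"
      using fS by (simp add: sum.If_cases Int_def)
    ultimately show ?thesis using card_mono[of e0 "S \<inter> e0"] by simp
  qed
  have swap: "(\<Sum>x\<in>T. \<Sum>y\<in>nbrs G x \<inter> S. h {x, y}) = (\<Sum>y\<in>S. \<Sum>x\<in>nbrs G y \<inter> T. h {y, x})"
  proof -
    have "(\<Sum>x\<in>T. \<Sum>y\<in>{y \<in> S. y \<in> nbrs G x}. h {x, y}) = (\<Sum>y\<in>S. \<Sum>x\<in>{x \<in> T. y \<in> nbrs G x}. h {x, y})"
      by (rule sum.swap_restrict[OF fT fS])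
    moreover have "{y \<in> S. y \<in> nbrs G x} = nbrs G x \<inter> S" for x by auto
    moreover have "{x \<in> T. y \<in> nbrs G x} = nbrs G y \<inter> T" if "y \<in> S" for y
      using nbrs_sym[of _ G] TV SV that by blast
    ultimately show ?thesis by (simp add: insert_commute)
  qed
  \<comment> \<open>The weight between \<open>S\<close> and \<open>T\<close> is counted from both
    sides; strictness then comes from \<open>m < a\<close> and \<open>T \<noteq> {}\<close>.\<close>
  have "real b * card S \<le> (\<Sum>y\<in>S. (\<Sum>x\<in>nbrs G y \<inter> T. h {y, x}) + (if y \<in> e0 then 1 else 0))"
    using sum_mono[of S "\<lambda>_. real b", OF Sflow] by (simp add: mult.commute)
  also have "\<dots> \<le> (\<Sum>x\<in>T. \<Sum>y\<in>nbrs G x \<inter> S. h {x, y}) + 2"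
    using e0S by (simp add: sum.distrib swap)
  also have "(\<Sum>x\<in>T. \<Sum>y\<in>nbrs G x \<inter> S. h {x, y}) = (\<Sum>x\<in>T. m - real (card (nbrs G x - S)))"
    using split by (intro sum.cong) auto
  also have "\<dots> = m * card T - (\<Sum>x\<in>T. real (card (nbrs G x - S)))"
    by (simp add: sum_subtractf)
  also have "m * card T < a * card T"
    using ma Tne fT by (simp add: card_gt_0_iff)
  finally have "real (b * card S + (\<Sum>x\<in>T. card (nbrs G x - S))) < real (a * card T + 2)"
    by simp
  then have "b * card S + (\<Sum>x\<in>T. card (nbrs G x - S)) < a * card T + 2"
    by (simp only: of_nat_less_iff)
  moreover have "card (nbrs G x - S) < a" if "x \<in> T" for x
  proof -
    have "(\<Sum>y\<in>nbrs G x \<inter> S. h {x, y}) \<ge> 0" by (intro sum_nonneg h01)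
    then have "real (card (nbrs G x - S)) < real a" using split[OF that] ma by linarith
    then show ?thesis by simp
  qed
  ultimately show thesis using that[OF SV TV ST Tne] by blast
qed


section \<open>Real inequalities excluding the obstruction\<close>

text \<open>Here \<open>i\<close>, \<open>s\<close>, \<open>t\<close> are the sizes of
  \<open>I\<close>, \<open>S\<close>, \<open>T\<close>; \<open>h\<close> is the least degree into
  the complement of \<open>S\<close> on \<open>T\<close>, and \<open>d\<close> the degree in
  \<open>G\<close> of a vertex attaining it. Eliminating \<open>t\<close> and \<open>s\<close>
  bounds \<open>d\<close> from above; that bound is largest at \<open>h = 1\<close>, where it
  contradicts the lower bound.\<close>

lemma positive_min_degree_absurd:
  fixes A B N i s t h d :: real
  assumes "2 \<le> A" "A \<le> B"
    and N: "B * N \<ge> (A + 2 * B) * (A + B - 2) + 2"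
    and d: "(A + 2 * B - 1) * d > (A + B - 1) * N + A + B"
    and i: "(A + 2 * B - 1) * i < B * N - (A + B)"
    and ds: "d \<le> s + i + h" and t: "t \<le> N - i - s"
    and st: "B * s + h * t \<le> A * t + 1"
    and h: "h = 1 \<or> 2 \<le> h" "h \<le> A"
  shows False
proof -
  define c where "c = A + B"
  define M where "M = N - i"
  define D where "D = A + 2 * B - 1"
  have D0: "D > 0" and ch: "c - h > 0" and c1: "c - 1 > 0"
    using assms(1,2) h by (auto simp: D_def c_def)
  have "B * s \<le> (A - h) * t + 1" using st by (simp add: algebra_simps)
  also have "\<dots> \<le> (A - h) * (N - i - s) + 1"
    using mult_left_mono[OF t, of "A - h"] h(2) by simp
  finally have s: "(c - h) * s \<le> (A - h) * M + 1"
    by (simp add: c_def M_def algebra_simps)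
  have "(c - h) * d \<le> (c - h) * (s + i + h)"
    using mult_left_mono[OF ds, of "c - h"] ch by simp
  then have "(c - h) * d \<le> (c - h) * (i + h) + (A - h) * M + 1"
    using s by (simp add: algebra_simps)
  from mult_left_mono[OF this, of "c - 1"] c1
  have 1: "(c - 1) * ((c - h) * d) \<le> (c - 1) * ((c - h) * (i + h) + (A - h) * M + 1)"
    by simp
  \<comment> \<open>As \<open>D - B = c - 1\<close>, the bound on \<open>i\<close> bounds
    \<open>M\<close> from below; the order bound then enters through
    \<open>D + 1 = A + 2 * B\<close>.\<close>
  have DM: "D * (B * M) > D * ((c - 1) * (c - 2) + c)"
  proof -
    have "D * M > (c - 1) * N + c" using i by (simp add: D_def M_def c_def algebra_simps)
    then have "B * (D * M) > B * ((c - 1) * N + c)"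
      using assms(1,2) by (intro mult_strict_left_mono) auto
    moreover have "(c - 1) * (B * N) \<ge> (c - 1) * ((D + 1) * (c - 2) + 2)"
      using N c1 by (intro mult_left_mono) (auto simp: D_def c_def)
    moreover have "(c - 1) * ((D + 1) * (c - 2) + 2) + B * c = D * ((c - 1) * (c - 2) + c)"
      by (simp add: D_def c_def algebra_simps)
    ultimately show ?thesis by (simp add: algebra_simps)
  qed
  \<comment> \<open>This sign compares the upper bounds on \<open>d\<close> for \<open>h\<close> and
    for 1. If \<open>h \<noteq> 1\<close>, then \<open>c - h \<le> c - 2\<close>, which
    \<open>DM\<close> covers.\<close>
  have nn: "(h - 1) * (M * B - 1 - (c - 1) * (c - h)) \<ge> 0"
  proof (cases "h = 1")
    case False
    then have "(c - 1) * (c - h) \<le> (c - 1) * (c - 2)" 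
      using h c1 by (intro mult_left_mono) auto
    moreover have "B * M > (c - 1) * (c - 2) + c"
      using DM D0 by (simp only: mult_less_cancel_left_pos)
    ultimately have "M * B - 1 - (c - 1) * (c - h) \<ge> 0" 
      using c1 by (subst mult.commute[of M B]) linarith
    then show ?thesis using False h by auto
  qed simp
  have "(c - h) * ((c - 1) * (i + 1) + (A - 1) * M + 1)
      - (c - 1) * ((c - h) * (i + h) + (A - h) * M + 1)
      = (h - 1) * (M * B - 1 - (c - 1) * (c - h))"
    by (simp add: c_def algebra_simps)
  then have "(c - h) * ((c - 1) * d) \<le> (c - h) * ((c - 1) * (i + 1) + (A - 1) * M + 1)"
    using 1 nn by (simp add: mult.left_commute)
  then have "(c - 1) * d \<le> (c - 1) * (i + 1) + (A - 1) * M + 1"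
    using ch by (simp only: mult_le_cancel_left_pos)
  from mult_left_mono[OF this, of D] D0
  have "D * ((c - 1) * d) \<le> D * ((c - 1) * (i + 1) + (A - 1) * M + 1)" by simp
  also have "\<dots> = D * c + D * (A - 1) * N + B * (D * i)"
    by (simp add: c_def M_def algebra_simps)
  also have "\<dots> \<le> D * c + D * (A - 1) * N + B * (B * N - c)"
    using i assms(1,2) by (intro add_left_mono mult_left_mono) (auto simp: D_def c_def)
  \<comment> \<open>The coefficient of \<open>N\<close> is the perfect square
    \<open>(A - 1 + B) * (A - 1 + B)\<close>, and \<open>D - B = c - 1\<close>.\<close>
  also have "\<dots> = (c - 1) * ((c - 1) * N + c)"
    by (simp add: c_def D_def algebra_simps)
  also have "\<dots> < (c - 1) * (D * d)"
    using d c1 by (intro mult_strict_left_mono) (auto simp: D_def c_def)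
  finally show False by (simp add: mult.left_commute)
qed

text \<open>Here \<open>w\<close> is the number of vertices outside \<open>S\<close> and
  \<open>I\<close>, and \<open>p\<close> counts those in \<open>T\<close> isolated in
  \<open>H - S\<close>. Eliminating \<open>s\<close> and \<open>p\<close> leaves \<open>w\<close>
  with coefficient \<open>A + B - 1 - \<beta>\<close>; once this is known to be non-negative, the
  bounds on \<open>w\<close> and \<open>i\<close> can be inserted.\<close>

lemma zero_min_degree_absurd:
  fixes A B N i s w p \<beta> :: real
  assumes "2 \<le> A" "A \<le> B"
    and N: "B * N \<ge> (A + 2 * B) * (A + B - 2) + 2"
    and \<beta>: "\<beta> * (B * N - (A + B)) = (A + 2 * B - 1) * (N - 1)"
    and i: "(A + 2 * B - 1) * i < B * N - (A + B)"
    and w: "(A + 2 * B - 1) * w < B * N - (A + B)"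
    and p: "N - p > \<beta> * w" and s: "s = N - i - w"
    and st: "B * s \<le> (A - 1) * w + p + 1"
  shows False
proof -
  define D where "D = A + 2 * B - 1"
  define K where "K = B * N - (A + B)"
  \<comment> \<open>In these variables the polynomials to be estimated have non-negative
    coefficients only.\<close>
  obtain x y where xy: "A = 2 + x" "B = 2 + x + y" "x \<ge> 0" "y \<ge> 0"
    using assms(1,2) by (metis add.commute add_diff_cancel_left' diff_add_cancel diff_ge_0_iff_ge)
  have D0: "D > 0" using assms(1,2) by (simp add: D_def)
  have "(A + 2 * B) * (A + B - 2) \<ge> (A + 2 * B) * 2"
    using assms(1,2) by (intro mult_left_mono) auto
  then have K0: "K > 0" using N assms(1,2) by (simp add: K_def)
  \<comment> \<open>The difference of the two sides is linear in \<open>B * N\<close> with slope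
    \<open>q \<ge> 0\<close>, so it suffices to check the least admissible value of
    \<open>B * N\<close>.\<close>
  have "B * (\<beta> * K) \<le> B * ((A + B - 1) * K)"
  proof -
    define q where "q = (A + B - 1) * B - D"
    have q: "q \<ge> 0" unfolding q_def D_def xy(1,2) using xy(3,4) by (simp add: algebra_simps)
    have "0 \<le> q * ((A + 2 * B) * (A + B - 2) + 2) - (A + B - 1) * B * (A + B) + D * B"
      unfolding q_def D_def xy(1,2) using xy(3,4)
      by (simp add: algebra_simps)
    also have "\<dots> \<le> q * (B * N) - (A + B - 1) * B * (A + B) + D * B"
      using mult_left_mono[OF N q] by simp
    also have "\<dots> = B * ((A + B - 1) * K) - B * (D * (N - 1))"
      by (simp add: q_def D_def K_def algebra_simps)
    finally show ?thesis using \<beta> by (simp add: K_def D_def)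
  qed
  then have "\<beta> \<le> A + B - 1" using K0 assms(1,2) by simp
  then have "(A + B - 1 - \<beta>) * (D * w) \<le> (A + B - 1 - \<beta>) * K"
    using w by (intro mult_left_mono) (auto simp: D_def K_def)
  moreover have "B * (D * i) \<le> B * K"
    using i assms(1,2) by (intro mult_left_mono) (auto simp: D_def K_def)
  moreover have "B * (N - i) < (A + B - 1 - \<beta>) * w + N + 1"
    using st p by (simp add: s algebra_simps)
  then have "D * (B * (N - i)) < D * ((A + B - 1 - \<beta>) * w + N + 1)"
    using D0 by simp
  ultimately have "D * (B * N) < (A + 2 * B - 1) * K - \<beta> * K + D * (N + 1)"
    by (simp add: algebra_simps)
  \<comment> \<open>Since \<open>\<beta> * K = D * (N - 1)\<close>, only \<open>2 * D\<close>
    survives, and \<open>A + B \<ge> 4\<close> exceeds that 2.\<close>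
  also have "\<dots> = D * (K + 2)" using \<beta> by (simp add: D_def K_def algebra_simps)
  finally have "B * N < K + 2" using D0 by simp
  then show False using assms(1,2) by (simp add: K_def)
qed

section \<open>Binding number and vertex deletion\<close>

lemma binding_number_less_ratio:
  assumes "simple_graph G" "binding_number G > \<beta>"
    and "X \<noteq> {}" "X \<subseteq> verts G" "nbrs_set G X \<noteq> verts G"
  shows "\<beta> * card X < card (nbrs_set G X)"
proof -
  have V: "verts G \<noteq> {}" "finite (verts G)" using assms by (auto simp: simple_graph_def)
  have "real (card (nbrs_set G X)) / real (card X) \<in> binding_ratios G"
    using assms(3-5) by (auto simp: binding_ratios_def)
  then have "binding_number G \<le> real (card (nbrs_set G X)) / real (card X)"
    unfolding binding_number_def
    by (rule Min_le[OF binding_ratios_finite_nonempty(1)[OF assms(1) V(1)]])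
  moreover have "card X > 0" using assms(3,4) V(2) by (simp add: card_gt_0_iff finite_subset)
  ultimately show ?thesis
    using less_le_trans[OF assms(2)] by (simp add: pos_less_divide_eq[symmetric])
qed

lemma nbrs_set_subset: "nbrs_set G X \<subseteq> verts G"
  by (auto simp: nbrs_set_def nbrs_def)

lemma simple_graph_delete_verts: "simple_graph G \<Longrightarrow> simple_graph (delete_verts G I)"
  by (auto simp: simple_graph_def delete_verts_def induced_def)

lemma verts_delete_verts [simp]: "verts (delete_verts G I) = verts G - I"
  by (simp add: delete_verts_def induced_def)

lemma nbrs_delete_verts: "x \<in> verts G - I \<Longrightarrow> nbrs (delete_verts G I) x = nbrs G x - I"
  by (auto simp: nbrs_def delete_verts_def induced_def)

lemma independent_set_avoids_nbrs:
  assumes "independent_set G I" "v \<in> I"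
  shows "I \<subseteq> verts G - nbrs G v"
  using assms by (auto simp: independent_set_def induced_def nbrs_def)

section \<open>Testing the binding number against the obstruction\<close>

theorem theorem1p2:
  fixes a b n :: nat and G :: "'a graph"
  assumes "2 \<le> a" and "a \<le> b"
    and "simple_graph G" and "graph_order G = n"
    and "real n \<ge> ((real a + 2 * real b) * (real a + real b - 2) + 2) / real b"
    and "binding_number G >
           ((real a + 2 * real b - 1) * (real n - 1)) / (real b * real n - (real a + real b))"
  shows "fractional_ID_factor_critical_covered a b G"
  unfolding fractional_ID_factor_critical_covered_def fractional_covered_def
proof (intro allI impI ballI)
  fix I e0
  let ?H = "delete_verts G I"
  assume I: "independent_set G I" and e0: "e0 \<in> edges ?H"
  have ab: "2 \<le> real a" "real a \<le> real b" using assms(1,2) by auto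
  have fV: "finite (verts G)" and nV: "card (verts G) = n"
    using assms(3,4) by (auto simp: simple_graph_def graph_order_def)
  have IV: "I \<subseteq> verts G" using I by (simp add: independent_set_def)
  define D where "D = real a + 2 * real b - 1"
  define K where "K = real b * real n - (real a + real b)"
  define \<beta> where "\<beta> = D * (real n - 1) / K"
  have N: "real b * real n \<ge> (real a + 2 * real b) * (real a + real b - 2) + 2"
    using assms(5) ab by (simp add: field_simps)
  have K0: "K > 0"
  proof -
    have "(real a + 2 * real b) * (real a + real b - 2) \<ge> (real a + 2 * real b) * 2"
      using ab by (intro mult_left_mono) auto
    then show ?thesis using N ab by (simp add: K_def)
  qed
  have D0: "D > 0" using ab by (simp add: D_def)
  have n1: "real n > 1"
  proof -
    have "real b * 1 < real b * real n" using K0 ab unfolding K_def by linarith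
    then show ?thesis using ab by simp
  qed
  have bind: "\<beta> * card X < card (nbrs_set G X)"
    if "X \<noteq> {}" "X \<subseteq> verts G" "nbrs_set G X \<noteq> verts G" for X
    using assms(6) unfolding \<beta>_def D_def K_def
    by (rule binding_number_less_ratio[OF assms(3) _ that])
  \<comment> \<open>No non-neighbour of \<open>v\<close> is adjacent to \<open>v\<close>, so the
    test set is admissible and its neighbourhood has at most \<open>n - 1\<close> vertices; this
    factor cancels against the one in \<open>\<beta>\<close>.\<close>
  have codeg: "D * card (verts G - nbrs G v) < K" if v: "v \<in> verts G" for v
  proof -
    let ?X = "verts G - nbrs G v"
    have sub: "nbrs_set G ?X \<subseteq> verts G - {v}"
      using nbrs_sym[of v G] by (auto simp: nbrs_set_def nbrs_def insert_commute)
    have "v \<in> ?X" using v not_in_own_nbrs[OF assms(3)] by simp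
    then have "\<beta> * card ?X < card (nbrs_set G ?X)" using sub v by (intro bind) auto
    also have "\<dots> \<le> real (card (verts G - {v}))"
      using card_mono[OF _ sub] fV by simp
    also have "\<dots> = real n - 1" using v fV nV n1 by (simp add: of_nat_diff)
    finally have "(real n - 1) * (D * card ?X) < (real n - 1) * K"
      using K0 by (simp add: \<beta>_def field_simps)
    then show ?thesis using n1 by simp
  qed
  \<comment> \<open>A nonempty independent set lies among the non-neighbours of any of its
    members.\<close>
  have iK: "D * card I < K"
  proof (cases "I = {}")
    case False
    then obtain v where v: "v \<in> I" by blast
    have "card I \<le> card (verts G - nbrs G v)"
      using independent_set_avoids_nbrs[OF I v] fV by (intro card_mono) auto
    then have "D * card I \<le> D * card (verts G - nbrs G v)" using D0 by simp
    then show ?thesis using codeg[of v] v IV by fastforce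
  qed (use K0 in simp)
  show "\<exists>h H. fractional_factor a b ?H h H \<and> h e0 = 1"
  proof (rule ccontr)
    assume no: "\<not> ?thesis"
    have "1 \<le> b" using assms(1,2) by simp
    then obtain S T where SV: "S \<subseteq> verts ?H" and TV: "T \<subseteq> verts ?H" and ST: "S \<inter> T = {}" "T \<noteq> {}"
      and ga: "\<And>x. x \<in> T \<Longrightarrow> card (nbrs ?H x - S) < a"
      and viol: "b * card S + (\<Sum>x\<in>T. card (nbrs ?H x - S)) < a * card T + 2"
      using not_covered_obstruction[OF simple_graph_delete_verts[OF assms(3)] e0 assms(2) _ no]
      by metis
    define g where "g x = card (nbrs ?H x - S)" for x
    have fin: "finite S" "finite T" "finite I"
      using SV TV IV fV by (auto intro: finite_subset)
    define Y where "Y = verts G - (S \<union> I)"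
    have TY: "T \<subseteq> Y" and fY: "finite Y" using TV ST fV by (auto simp: Y_def)
    have "card (S \<union> I) = card S + card I" "S \<union> I \<subseteq> verts G"
      using SV IV fin by (auto intro!: card_Un_disjoint)
    then have sY: "real (card S) = real n - card I - card Y"
      using card_Diff_subset[of "S \<union> I" "verts G"] card_mono[of "verts G" "S \<union> I"] fin fV nV
      by (simp add: Y_def of_nat_diff)
    have tY: "card T \<le> card Y" by (rule card_mono[OF fY TY])
    define h where "h = Min (g ` T)"
    have hle: "x \<in> T \<Longrightarrow> h \<le> g x" for x using fin by (simp add: h_def)
    have "h \<in> g ` T" unfolding h_def using fin ST by (intro Min_in) auto
    then obtain x1 where x1: "x1 \<in> T" "g x1 = h" by auto
    have x1V: "x1 \<in> verts G - I" using x1 TV by auto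
    \<comment> \<open>Beyond \<open>S\<close> and \<open>I\<close>, the vertex \<open>x1\<close> has
      exactly \<open>h\<close> neighbours.\<close>
    have "nbrs G x1 \<subseteq> (nbrs ?H x1 - S) \<union> (S \<union> I)"
      using nbrs_delete_verts[OF x1V] by auto
    then have "card (nbrs G x1) \<le> card ((nbrs ?H x1 - S) \<union> (S \<union> I))"
      using fin finite_nbrs[OF simple_graph_delete_verts[OF assms(3)]] by (intro card_mono) auto
    also have "\<dots> \<le> h + (card S + card I)"
      using card_Un_le[of "nbrs ?H x1 - S" "S \<union> I"] card_Un_le[of S I] x1(2)
      by (simp add: g_def)
    finally have deg: "real (card (nbrs G x1)) \<le> real (card S) + real (card I) + real h" by simp
    have x1K: "D * (real n - card (nbrs G x1)) < K"
    proof -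
      have sub: "nbrs G x1 \<subseteq> verts G" by (auto simp: nbrs_def)
      then have "real (card (verts G - nbrs G x1)) = real n - card (nbrs G x1)"
        using card_Diff_subset[OF finite_nbrs[OF assms(3)] sub] card_mono[OF fV sub] nV
        by (simp add: of_nat_diff)
      then show ?thesis using codeg[of x1] x1V by simp
    qed
    \<comment> \<open>Integrality turns \<open>< ... + 2\<close> into
      \<open>\<le> ... + 1\<close>.\<close>
    have viol': "real b * card S + (\<Sum>x\<in>T. real (g x)) \<le> real a * card T + 1"
    proof -
      have "real (b * card S + (\<Sum>x\<in>T. g x)) \<le> real (a * card T + 1)"
        using viol unfolding of_nat_le_iff g_def by simp
      then show ?thesis by simp
    qed
    show False
    proof (cases "h = 0")
      case False
      have "real h * card T \<le> (\<Sum>x\<in>T. real (g x))"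
        using sum_mono[of T "\<lambda>_. real h" "\<lambda>x. real (g x)"] hle by (simp add: mult.commute)
      then have "real b * card S + real h * card T \<le> real a * card T + 1"
        using viol' by simp
      moreover have "D * card (nbrs G x1) > (real a + real b - 1) * real n + real a + real b"
        using x1K by (simp add: D_def K_def algebra_simps)
      moreover have "real h = 1 \<or> 2 \<le> real h" "real h \<le> real a"
        using False ga[OF x1(1)] x1(2) by (auto simp: g_def)
      moreover have "real (card T) \<le> real n - card I - card S"
        using tY sY by simp
      ultimately show False
        using positive_min_degree_absurd[OF ab N _ iK[unfolded D_def K_def] deg]
        unfolding D_def by blast
    next
      case True
      define P where "P = {x \<in> T. g x = 0}"
      have PT: "P \<subseteq> T" and P1: "x1 \<in> P" using x1 True by (auto simp: P_def)
      have fP: "finite P" using PT fin finite_subset by blast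
      \<comment> \<open>Every vertex of \<open>T\<close> outside \<open>P\<close> contributes at
        least 1.\<close>
      have "real (card T) - card P \<le> (\<Sum>x\<in>T. real (g x))"
      proof -
        have "real (card T) - card P = (\<Sum>x\<in>T - P. 1)"
          using card_Diff_subset[OF fP PT] card_mono[OF fin(2) PT] by (simp add: of_nat_diff)
        also have "\<dots> \<le> (\<Sum>x\<in>T - P. real (g x))" by (intro sum_mono) (auto simp: P_def)
        also have "\<dots> \<le> (\<Sum>x\<in>T. real (g x))" using fin by (intro sum_mono2) auto
        finally show ?thesis .
      qed
      then have "real b * card S \<le> (real a - 1) * card T + card P + 1"
        using viol' by (simp add: algebra_simps)
      also have "\<dots> \<le> (real a - 1) * card Y + card P + 1"
        using tY ab by (intro add_right_mono mult_left_mono) auto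
      finally have st: "real b * card S \<le> (real a - 1) * card Y + card P + 1" .
      \<comment> \<open>With \<open>h = 0\<close>, all neighbours of \<open>x1\<close> lie in
        \<open>S\<close> or \<open>I\<close>, so \<open>Y\<close> is no larger than the set of its
        non-neighbours.\<close>
      have "D * card Y \<le> D * (real n - card (nbrs G x1))"
        using deg sY True D0 by (intro mult_left_mono) auto
      then have w: "D * card Y < K" using x1K by simp
      \<comment> \<open>Vertices of \<open>P\<close> have no neighbour in \<open>Y\<close>. As
        \<open>x1\<close> lies in \<open>P\<close>, the neighbourhood of \<open>Y\<close> is not all
        of \<open>verts G\<close>, so \<open>Y\<close> is admissible.\<close>
      have sub: "nbrs_set G Y \<subseteq> verts G - P"
      proof -
        have False if "y \<in> Y" "x \<in> nbrs G y" "x \<in> P" for x y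
        proof -
          have "y \<in> nbrs G x" using that nbrs_sym[of x G y] by (auto simp: Y_def)
          moreover have "x \<in> verts G - I" "card (nbrs ?H x - S) = 0"
            using that TV by (auto simp: P_def g_def)
          moreover have "finite (nbrs ?H x - S)"
            using finite_nbrs[OF simple_graph_delete_verts[OF assms(3)]] by blast
          ultimately show False using nbrs_delete_verts[of x G I] that(1) by (auto simp: Y_def)
        qed
        then show ?thesis using nbrs_set_subset[of G Y] by (auto simp: nbrs_set_def)
      qed
      have PV: "P \<subseteq> verts G" using PT TV by auto
      have "\<beta> * card Y < card (nbrs_set G Y)"
        using sub P1 PV TY ST by (intro bind) (auto simp: Y_def)
      also have "\<dots> \<le> real (card (verts G - P))"
        using card_mono[OF _ sub] fV by simp
      also have "\<dots> = real n - card P"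
        using card_Diff_subset[OF fP PV] card_mono[OF fV PV] nV by (simp add: of_nat_diff)
      finally have p: "real n - card P > \<beta> * card Y" .
      have "\<beta> * K = D * (real n - 1)" using K0 by (simp add: \<beta>_def)
      then show False
        using zero_min_degree_absurd[OF ab N _ _ _ p sY st] iK w
        unfolding D_def K_def by blast
    qed
  qed
qed

end
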